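(* For $n\ge 0$ let $I_n(x)=\prod_{i=1}^n\left(1+x^{F_{i+1}}\right)$ (so $I_0(x)=1$), where $F_j$ are the Fibonacci numbers with $F_1=F_2=1$, $F_{j+1}=F_j+F_{j-1}$. Write $I_n(x)=\sum_{k\ge 0}c_n(k)x^k$ and set $v_2(n)=\sum_{k\ge 0}c_n(k)^2$ (so $v_2(0)=1$, $v_2(1)=2$, $v_2(2)=4$, $v_2(3)=10$). Then $$\sum_{n\ge 0}v_2(n)x^n=\frac{1-2x^2}{1-2x-2x^2+2x^3}.$$ *)

theory Defs
  imports
    "HOL-Computational_Algebra.Computational_Algebra"
    "HOL-Number_Theory.Fib"
begin

definition fib_prod :: "nat \<Rightarrow> int poly" where
  "fib_prod n = (\<Prod>i = 1..n. 1 + monom 1 (fib (i + 1)))"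

text \<open>All coefficients above the degree vanish, so this finite sum is the sum over all \<open>k\<close>.\<close>

definition v2 :: "nat \<Rightarrow> int" where
  "v2 n = (\<Sum>k \<le> degree (fib_prod n). (coeff (fib_prod n) k)\<^sup>2)"

lemma v2_initial_values: "v2 0 = 1" "v2 1 = 2" "v2 2 = 4" "v2 3 = 10"
proof -
  have eqs: "fib_prod 0 = 1" "fib_prod 1 = [:1, 1:]" "fib_prod 2 = [:1, 1, 1, 1:]"
    "fib_prod 3 = [:1, 1, 1, 2, 1, 1, 1:]"
    by (simp_all add: fib_prod_def numeral_eq_Suc prod.nat_ivl_Suc' monom_Suc monom_0 one_pCons)
  show "v2 0 = 1" "v2 1 = 2" "v2 2 = 4" "v2 3 = 10"
    unfolding v2_def eqs by (simp_all add: numeral_eq_Suc)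
qed

end

theory Submission
  imports Defs
begin

text \<open>
  Write \<open>C\<^sub>n(d) = \<Sum>k. c\<^sub>n(k) c\<^sub>n(k + d)\<close>, so that \<open>v\<^sub>2(n) = C\<^sub>n(0)\<close>. Since
  \<open>I\<^sub>n\<^sub>+\<^sub>1 = (1 + x\<^sup>F) I\<^sub>n\<close> with \<open>F = F\<^sub>n\<^sub>+\<^sub>2\<close>, we have
  \<open>C\<^sub>n\<^sub>+\<^sub>1(0) = 2 C\<^sub>n(0) + 2 C\<^sub>n(F)\<close> and
  \<open>C\<^sub>n\<^sub>+\<^sub>1(F + e) = 2 C\<^sub>n(F + e) + C\<^sub>n(e) + C\<^sub>n(2F + e)\<close>. The degree of \<open>I\<^sub>n\<close> is less than
  \<open>F\<^sub>n\<^sub>+\<^sub>3\<close>, which kills most terms when \<open>F + e\<close> is \<open>F\<^sub>n\<^sub>+\<^sub>3\<close> or \<open>F\<^sub>n\<^sub>+\<^sub>2\<close>. What remains is a closed linear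
  system for \<open>C\<^sub>n(0)\<close>, \<open>C\<^sub>n(F\<^sub>n\<^sub>+\<^sub>1)\<close>, \<open>C\<^sub>n(F\<^sub>n\<^sub>+\<^sub>2)\<close>, and eliminating the last two gives
  \<open>v\<^sub>2(n+3) = 2 v\<^sub>2(n+2) + 2 v\<^sub>2(n+1) - 2 v\<^sub>2(n)\<close>.
\<close>

definition coeff_inner :: "'a::comm_ring_1 poly \<Rightarrow> 'a poly \<Rightarrow> 'a" where
  "coeff_inner p q = (\<Sum>k\<le>degree p. coeff p k * coeff q k)"

lemma coeff_inner_eq_sum:
  assumes "degree p \<le> N"
  shows "coeff_inner p q = (\<Sum>k\<le>N. coeff p k * coeff q k)"
  unfolding coeff_inner_def
  by (rule sum.mono_neutral_left) (use assms in \<open>auto simp: coeff_eq_0\<close>)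

lemma coeff_inner_commute: "coeff_inner p q = coeff_inner q p"
  using coeff_inner_eq_sum[of p "max (degree p) (degree q)" q]
    coeff_inner_eq_sum[of q "max (degree p) (degree q)" p]
  by (simp add: mult.commute)

lemma coeff_inner_add_right: "coeff_inner p (q + r) = coeff_inner p q + coeff_inner p r"
  by (simp add: coeff_inner_def algebra_simps sum.distrib)

lemma coeff_inner_add_left: "coeff_inner (p + q) r = coeff_inner p r + coeff_inner q r"
  by (metis coeff_inner_add_right coeff_inner_commute)

lemma coeff_inner_monom_mult_cancel:
  "coeff_inner (monom 1 m * p) (monom 1 m * q) = coeff_inner p q"
proof -
  have "degree (monom 1 m * p) \<le> m + degree p"
    by (rule order.trans[OF degree_mult_le]) (simp add: degree_monom_le)
  then have "coeff_inner (monom 1 m * p) (monom 1 m * q) =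
      (\<Sum>k\<le>m + degree p. coeff (monom 1 m * p) k * coeff (monom 1 m * q) k)"
    by (rule coeff_inner_eq_sum)
  also have "\<dots> = (\<Sum>k\<in>{m..m + degree p}. coeff p (k - m) * coeff q (k - m))"
    by (rule sum.mono_neutral_cong_right) (auto simp: coeff_monom_mult)
  also have "\<dots> = coeff_inner p q"
    unfolding coeff_inner_def
    by (rule sum.reindex_bij_witness[where i = "\<lambda>k. k + m" and j = "\<lambda>k. k - m"]) auto
  finally show ?thesis .
qed

text \<open>Shifting by multiplication with \<open>monom 1 d\<close> pairs index \<open>k\<close>
  with \<open>k - d\<close>, the same sum as \<open>k\<close> with \<open>k + d\<close>, but without
  truncated subtraction.\<close>

definition autocorr :: "'a::comm_ring_1 poly \<Rightarrow> nat \<Rightarrow> 'a" where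
  "autocorr p d = coeff_inner p (monom 1 d * p)"

lemma autocorr_eq_0: "degree p < d \<Longrightarrow> autocorr p d = 0"
  by (auto simp: autocorr_def coeff_inner_def coeff_monom_mult intro!: sum.neutral)

lemma coeff_inner_monom_mult_add:
  "coeff_inner (monom 1 a * p) (monom 1 (a + d) * p) = autocorr p d"
proof -
  have "monom 1 (a + d) * p = monom 1 a * (monom 1 d * p)"
    by (simp add: mult_monom flip: mult.assoc)
  then show ?thesis
    by (simp add: coeff_inner_monom_mult_cancel autocorr_def)
qed

lemma autocorr_binomial_mult_0:
  "autocorr (p + monom 1 a * p) 0 = 2 * autocorr p 0 + 2 * autocorr p a"
  using coeff_inner_monom_mult_add[of a p 0] coeff_inner_commute[of "monom 1 a * p" p]
  by (simp add: autocorr_def coeff_inner_add_left coeff_inner_add_right)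

text \<open>Expand into four pairings; in those whose left factor is \<open>monom 1 a * p\<close>,
  the common shift by \<open>a\<close> cancels.\<close>

lemma autocorr_binomial_mult:
  "autocorr (p + monom 1 a * p) (a + e) =
     2 * autocorr p (a + e) + autocorr p e + autocorr p (2 * a + e)"
proof -
  have "monom 1 (a + e) * (p + monom 1 a * p) =
      monom 1 (a + e) * p + monom 1 (a + (a + e)) * p"
    by (simp add: distrib_left mult_monom add_ac flip: mult.assoc)
  then have "autocorr (p + monom 1 a * p) (a + e) =
      autocorr p (a + e) + autocorr p (a + (a + e)) + (autocorr p e + autocorr p (a + e))"
    by (simp add: autocorr_def[of "p + monom 1 a * p"] coeff_inner_add_left coeff_inner_add_right
        coeff_inner_monom_mult_add)
      (simp add: autocorr_def)
  then show ?thesis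
    by (simp only: mult_2 add_ac)
qed

lemma fib_prod_Suc:
  "fib_prod (Suc n) = fib_prod n + monom 1 (fib (n + 2)) * fib_prod n"
  by (simp add: fib_prod_def algebra_simps)

text \<open>The exponents F_2, ..., F_(n+1) sum to F_(n+3) - 2.\<close>

lemma degree_fib_prod: "degree (fib_prod n) + 2 \<le> fib (n + 3)"
proof (induction n)
  case 0
  show ?case by (simp add: fib_prod_def numeral_3_eq_3)
next
  case (Suc n)
  have "degree (fib_prod (Suc n)) \<le> fib (n + 2) + degree (fib_prod n)"
    unfolding fib_prod_Suc
    by (intro degree_add_le order.trans[OF degree_mult_le]) (auto simp: degree_monom_le)
  moreover have "fib (Suc n + 3) = fib (n + 3) + fib (n + 2)"
    by (simp add: eval_nat_numeral)
  ultimately show ?case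
    using Suc.IH by linarith
qed

lemma v2_eq_autocorr: "v2 n = autocorr (fib_prod n) 0"
  by (simp add: v2_def autocorr_def coeff_inner_def power2_eq_square)

lemma v2_Suc: "v2 (Suc n) = 2 * v2 n + 2 * autocorr (fib_prod n) (fib (n + 2))"
  by (simp only: v2_eq_autocorr fib_prod_Suc autocorr_binomial_mult_0)

lemma fib_add_3: "fib (n + 3) = fib (n + 2) + fib (n + 1)"
  by (simp add: eval_nat_numeral)

lemma autocorr_fib_prod_Suc_fib_3:
  "autocorr (fib_prod (Suc n)) (fib (n + 3)) = autocorr (fib_prod n) (fib (n + 1))"
proof -
  \<comment> \<open>Here a = F_(n+2) and e = F_(n+1), so a + e = F_(n+3) already exceeds the
    degree.\<close>
  have "autocorr (fib_prod n) (fib (n + 2) + fib (n + 1)) = 0"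
    "autocorr (fib_prod n) (2 * fib (n + 2) + fib (n + 1)) = 0"
    using degree_fib_prod[of n] fib_add_3[of n] by (auto intro!: autocorr_eq_0)
  then show ?thesis
    unfolding fib_prod_Suc fib_add_3 autocorr_binomial_mult by simp
qed

lemma autocorr_fib_prod_Suc_fib_2:
  "autocorr (fib_prod (Suc n)) (fib (n + 2)) =
     2 * autocorr (fib_prod n) (fib (n + 2)) + v2 n"
proof -
  have "fib (n + 1) \<le> fib (n + 2)"
    by (rule fib_mono) simp
  \<comment> \<open>Now e = 0, and only the shift 2a >= F_(n+3) is out of range.\<close>
  then have "autocorr (fib_prod n) (2 * fib (n + 2)) = 0"
    using degree_fib_prod[of n] fib_add_3[of n] by (intro autocorr_eq_0) linarith
  then show ?thesis
    using autocorr_binomial_mult[of "fib_prod n" "fib (n + 2)" 0]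
    by (simp only: fib_prod_Suc v2_eq_autocorr add_0_right)
qed

lemma v2_recurrence: "v2 (n + 3) = 2 * v2 (n + 2) + 2 * v2 (n + 1) - 2 * v2 n"
proof -
  have "v2 (n + 3) = 2 * v2 (n + 2) + 2 * autocorr (fib_prod (Suc (Suc n))) (fib (Suc n + 3))"
    using v2_Suc[of "n + 2"] by (simp add: eval_nat_numeral)
  also have "autocorr (fib_prod (Suc (Suc n))) (fib (Suc n + 3)) =
      2 * autocorr (fib_prod n) (fib (n + 2)) + v2 n"
    using autocorr_fib_prod_Suc_fib_3[of "Suc n"] autocorr_fib_prod_Suc_fib_2[of n] by simp
  finally show ?thesis
    \<comment> \<open>\<open>v2_Suc\<close> at \<open>n\<close> turns twice the remaining
      autocorrelation into \<open>v2 (n + 1) - 2 * v2 n\<close>.\<close>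
    using v2_Suc[of n] by simp
qed

theorem theorem1:
  shows "Abs_fps (\<lambda>n. of_int (v2 n) :: rat) =
    (1 - 2 * fps_X ^ 2) / (1 - 2 * fps_X - 2 * fps_X ^ 2 + 2 * fps_X ^ 3)"
proof -
  define V where "V = Abs_fps (\<lambda>n. of_int (v2 n) :: rat)"
  define D :: "rat fps" where "D = 1 - 2 * fps_X - 2 * fps_X ^ 2 + 2 * fps_X ^ 3"
  have VD: "V * D = V - fps_const 2 * (fps_X * V) - fps_const 2 * (fps_X ^ 2 * V)
      + fps_const 2 * (fps_X ^ 3 * V)"
    by (simp add: D_def algebra_simps numeral_fps_const)
  have N: "1 - 2 * fps_X ^ 2 = 1 - fps_const 2 * (fps_X ^ 2 :: rat fps)"
    by (simp add: numeral_fps_const)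
  have "V * D = 1 - 2 * fps_X ^ 2"
  proof (rule fps_ext)
    fix n :: nat
    \<comment> \<open>The initial values give the numerator coefficients 1, 0, -2; from index 3 on
      the recurrence gives 0.\<close>
    have "n = 0 \<or> n = 1 \<or> n = 2 \<or> (\<exists>m. n = m + 3)"
      by presburger
    then consider "n = 0" | "n = 1" | "n = 2" | m where "n = m + 3"
      by blast
    then show "(V * D) $ n = (1 - 2 * fps_X ^ 2) $ n"
      unfolding VD N
    proof cases
      case (4 m)
      have "m + 3 - 2 = m + 1" "m + 3 - Suc 0 = m + 2" by simp_all
      then show "(V - fps_const 2 * (fps_X * V) - fps_const 2 * (fps_X ^ 2 * V)
          + fps_const 2 * (fps_X ^ 3 * V)) $ n = (1 - fps_const 2 * fps_X ^ 2) $ n"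
        by (simp add: 4 V_def fps_X_power_mult_nth fps_X_power_nth v2_recurrence)
    qed (use v2_initial_values in
        \<open>simp_all add: V_def fps_X_power_mult_nth fps_X_power_nth\<close>)
  qed
  moreover have "D $ 0 \<noteq> 0"
    by (simp add: D_def)
  then have "D \<noteq> 0"
    by auto
  ultimately show ?thesis
    unfolding V_def D_def by (metis nonzero_mult_div_cancel_right)
qed

end
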